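(* Let $0<\theta<\frac12$ and consider the postdoc (second-best choice) game with $N$ candidates presented in an order drawn from the Mallows distribution with parameter $\theta$. As $N\to\infty$, the optimal strategy is to reject the first $N-2$ candidates (all but the last two), then accept the next candidate that is a left-to-right maximum, and, if no selection has been made before the last candidate, accept the last candidate. The maximum probability of winning (in the limit $N\to\infty$) is $(1-\theta)(1-\theta+\theta^2)$.
   Context: Candidates are ranked $1,\dots,N$ ($N$ best, $N-1$ second best). The interview order is a permutation $\pi=[\pi_1\cdots\pi_N]\in S_N$ (the $i$-th interviewed candidate has rank $\pi_i$), drawn with probability $\theta^{\mathrm{inv}(\pi)}/\sum_{\rho\in S_N}\theta^{\mathrm{inv}(\rho)}$, where $\mathrm{inv}(\pi)$ is the number of pairs $i<j$ with $\pi_i>\pi_j$ (Mallows distribution). At time $i$ the decision maker knows only the relative order of $\pi_1,\dots,\pi_i$ and must irrevocably accept or reject candidate $i$; exactly one candidate must be accepted; the game is won if the accepted candidate has rank $N-1$. Candidate $i$ is a left-to-right maximum if $\pi_i>\pi_j$ for all $j<i$. *)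

theory Defs
  imports "HOL-Probability.Probability" "HOL-Combinatorics.Permutations"
begin

text \<open>
  An interview order is a function \<open>\<pi>\<close> with \<open>\<pi> permutes {1..N}\<close>; the candidate seen at time
  \<open>i\<close> has rank \<open>\<pi> i\<close>, where rank \<open>N\<close> is the best.
\<close>

definition inv_count :: "nat \<Rightarrow> (nat \<Rightarrow> nat) \<Rightarrow> nat" where
  "inv_count N \<pi> = card {(i, j). i \<in> {1..N} \<and> j \<in> {1..N} \<and> i < j \<and> \<pi> i > \<pi> j}"

definition mallows_pmf :: "nat \<Rightarrow> real \<Rightarrow> (nat \<Rightarrow> nat) pmf" where
  "mallows_pmf N \<theta> = embed_pmf (\<lambda>\<pi>. if \<pi> permutes {1..N}
     then \<theta> ^ inv_count N \<pi> / (\<Sum>\<rho> | \<rho> permutes {1..N}. \<theta> ^ inv_count N \<rho>) else 0)"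

text \<open>For \<open>\<theta> > 0\<close> the function above is a probability mass function, so \<open>embed_pmf\<close> is meaningful.\<close>

lemma pmf_mallows_pmf:
  assumes "0 < \<theta>"
  shows "pmf (mallows_pmf N \<theta>) \<pi> = (if \<pi> permutes {1..N}
     then \<theta> ^ inv_count N \<pi> / (\<Sum>\<rho> | \<rho> permutes {1..N}. \<theta> ^ inv_count N \<rho>) else 0)"
proof -
  let ?S = "{\<rho>. \<rho> permutes {1..N}}"
  let ?Z = "\<Sum>\<rho> | \<rho> permutes {1..N}. \<theta> ^ inv_count N \<rho>"
  let ?f = "\<lambda>\<pi>. if \<pi> permutes {1..N} then \<theta> ^ inv_count N \<pi> / ?Z else 0"
  have fin: "finite ?S"
    by (simp add: finite_permutations)
  have "id \<in> ?S"
    by (simp add: permutes_id)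
  then have "?S \<noteq> {}"
    by blast
  with fin have Z: "?Z > 0"
    using assms by (intro sum_pos) simp_all
  have nonneg: "0 \<le> ?f x" for x
    using Z assms by simp
  have "(\<integral>\<^sup>+ x. ennreal (?f x) \<partial>count_space UNIV) = (\<integral>\<^sup>+ x. ennreal (?f x) \<partial>count_space ?S)"
    by (subst nn_integral_count_space_indicator) (auto intro!: nn_integral_cong split: split_indicator)
  also have "\<dots> = (\<Sum>x\<in>?S. ennreal (?f x))"
    using fin by (rule nn_integral_count_space_finite)
  also have "\<dots> = ennreal (\<Sum>x\<in>?S. ?f x)"
    by (rule sum_ennreal) (rule nonneg)
  also have "(\<Sum>x\<in>?S. ?f x) = 1"
    using Z by (simp add: sum_divide_distrib[symmetric])
  finally have "(\<integral>\<^sup>+ x. ennreal (?f x) \<partial>count_space UNIV) = 1"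
    by simp
  with nonneg show ?thesis
    unfolding mallows_pmf_def by (subst pmf_embed_pmf) auto
qed

definition same_relative_order :: "nat \<Rightarrow> (nat \<Rightarrow> nat) \<Rightarrow> (nat \<Rightarrow> nat) \<Rightarrow> bool" where
  "same_relative_order i \<pi> \<rho> \<longleftrightarrow>
     (\<forall>j\<in>{1..i}. \<forall>k\<in>{1..i}. \<pi> j < \<pi> k \<longleftrightarrow> \<rho> j < \<rho> k)"

text \<open>
  \<open>d i \<pi>\<close> says that candidate \<open>i\<close> is accepted in the order \<open>\<pi>\<close>, provided that no earlier candidate
  has been accepted. The decision at time \<open>i\<close> may depend only on the relative order of
  \<open>\<pi> 1, \<dots>, \<pi> i\<close>, and some candidate has to be accepted in the end.
\<close>

definition strategy :: "nat \<Rightarrow> (nat \<Rightarrow> (nat \<Rightarrow> nat) \<Rightarrow> bool) \<Rightarrow> bool" where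
  "strategy N d \<longleftrightarrow>
     (\<forall>i\<in>{1..N}. \<forall>\<pi> \<rho>. \<pi> permutes {1..N} \<longrightarrow> \<rho> permutes {1..N} \<longrightarrow>
        same_relative_order i \<pi> \<rho> \<longrightarrow> d i \<pi> = d i \<rho>) \<and>
     (\<forall>\<pi>. \<pi> permutes {1..N} \<longrightarrow> (\<exists>i\<in>{1..N}. d i \<pi>))"

definition accepted :: "(nat \<Rightarrow> (nat \<Rightarrow> nat) \<Rightarrow> bool) \<Rightarrow> (nat \<Rightarrow> nat) \<Rightarrow> nat" where
  "accepted d \<pi> = (LEAST i. 1 \<le> i \<and> d i \<pi>)"

definition win_prob :: "nat \<Rightarrow> real \<Rightarrow> (nat \<Rightarrow> (nat \<Rightarrow> nat) \<Rightarrow> bool) \<Rightarrow> real" where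
  "win_prob N \<theta> d = measure_pmf.prob (mallows_pmf N \<theta>) {\<pi>. \<pi> (accepted d \<pi>) = N - 1}"

definition optimal_strategy :: "nat \<Rightarrow> real \<Rightarrow> (nat \<Rightarrow> (nat \<Rightarrow> nat) \<Rightarrow> bool) \<Rightarrow> bool" where
  "optimal_strategy N \<theta> d \<longleftrightarrow>
     strategy N d \<and> (\<forall>d'. strategy N d' \<longrightarrow> win_prob N \<theta> d' \<le> win_prob N \<theta> d)"

definition max_win_prob :: "nat \<Rightarrow> real \<Rightarrow> real" where
  "max_win_prob N \<theta> = (SUP d\<in>{d. strategy N d}. win_prob N \<theta> d)"

text \<open>The supremum is a maximum, attained by any optimal strategy.\<close>

lemma max_win_prob_optimal:
  assumes "optimal_strategy N \<theta> d"
  shows "max_win_prob N \<theta> = win_prob N \<theta> d"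
  unfolding max_win_prob_def
  by (rule cSup_eq_maximum) (use assms in \<open>auto simp: optimal_strategy_def\<close>)

definition lr_max :: "(nat \<Rightarrow> nat) \<Rightarrow> nat \<Rightarrow> bool" where
  "lr_max \<pi> i \<longleftrightarrow> (\<forall>j\<in>{1..<i}. \<pi> j < \<pi> i)"

definition reject_then_lr_max :: "nat \<Rightarrow> nat \<Rightarrow> nat \<Rightarrow> (nat \<Rightarrow> nat) \<Rightarrow> bool" where
  "reject_then_lr_max N k i \<pi> \<longleftrightarrow> k < i \<and> (lr_max \<pi> i \<or> i = N)"

end

theory Submission
  imports Defs
begin

text \<open>
  A permutation of \<open>{1..n + 2}\<close> arises from one of \<open>{1..n}\<close> by inserting the last two ranks, with
  \<open>a \<le> n\<close> and then \<open>b \<le> n + 1\<close> earlier candidates above the new one; the insertions multiply the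
  Mallows weight by \<open>\<theta> ^ a\<close> and \<open>\<theta> ^ b\<close>. So, whatever the relative order \<open>\<tau>\<close> of the first \<open>n\<close>
  candidates, the conditional weight of winning is a sum over \<open>a\<close> and \<open>b\<close>. With
  \<open>S = \<theta> + \<dots> + \<theta> ^ n\<close> the proposed strategy gets \<open>1 + \<theta> * S\<close>. Accepting any one of the first
  \<open>n\<close> candidates, even with full knowledge of \<open>\<tau>\<close>, gets at most \<open>(1 + \<theta>) * S\<close> or \<open>\<theta> * S * S\<close>,
  and \<open>S \<le> 1\<close> since \<open>\<theta> < 1 / 2\<close>. Hence no backward induction over earlier times is needed.
\<close>

section \<open>Inserting the last rank\<close>

text \<open>\<open>b\<close> is the number of earlier candidates above the newcomer, hence the
  number of inversions that it creates. The guard \<open>j \<in> {1..n}\<close> keeps the points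
  outside \<open>{1..Suc n}\<close> fixed, as \<open>permutes\<close> demands.\<close>

definition insert_rank :: "nat \<Rightarrow> nat \<Rightarrow> (nat \<Rightarrow> nat) \<Rightarrow> nat \<Rightarrow> nat" where
  "insert_rank n b \<sigma> j = (if j = Suc n then Suc n - b
     else if j \<in> {1..n} \<and> Suc n - b \<le> \<sigma> j then Suc (\<sigma> j) else \<sigma> j)"

lemma insert_rank_last [simp]: "insert_rank n b \<sigma> (Suc n) = Suc n - b"
  by (simp add: insert_rank_def)

lemma insert_rank_le:
  "j \<in> {1..n} \<Longrightarrow> insert_rank n b \<sigma> j = (if Suc n - b \<le> \<sigma> j then Suc (\<sigma> j) else \<sigma> j)"
  by (auto simp: insert_rank_def)

lemma insert_rank_less_iff:
  assumes "j \<in> {1..n}" "k \<in> {1..n}"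
  shows "insert_rank n b \<sigma> j < insert_rank n b \<sigma> k \<longleftrightarrow> \<sigma> j < \<sigma> k"
  using assms by (auto simp: insert_rank_le)

lemma permutes_insert_rank:
  assumes \<sigma>: "\<sigma> permutes {1..n}" and b: "b \<le> n"
  shows "insert_rank n b \<sigma> permutes {1..Suc n}"
proof (rule bij_imp_permutes)
  have \<sigma>_in: "\<sigma> j \<in> {1..n}" if "j \<in> {1..n}" for j
    using permutes_in_image[OF \<sigma>] that by blast
  have "insert_rank n b \<sigma> ` {1..Suc n} \<subseteq> {1..Suc n}"
  proof clarify
    fix j assume j: "j \<in> {1..Suc n}"
    show "insert_rank n b \<sigma> j \<in> {1..Suc n}"
    proof (cases "j = Suc n")
      case False
      then have "j \<in> {1..n}" using j by auto
      then show ?thesis using \<sigma>_in[of j] by (auto simp: insert_rank_le)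
    qed (use b in auto)
  qed
  moreover have "inj_on (insert_rank n b \<sigma>) {1..Suc n}"
  proof (rule linorder_inj_onI)
    fix j k assume jk: "j < k" "j \<in> {1..Suc n}" "k \<in> {1..Suc n}"
    then have j: "j \<in> {1..n}" by auto
    show "insert_rank n b \<sigma> j \<noteq> insert_rank n b \<sigma> k"
    proof (cases "k = Suc n")
      case True
      then show ?thesis using j by (auto simp: insert_rank_le)
    next
      case False
      then have k: "k \<in> {1..n}" using jk by auto
      have "\<sigma> j \<noteq> \<sigma> k"
        using permutes_inj[OF \<sigma>] jk by (auto dest: injD)
      then show ?thesis
        using insert_rank_less_iff[OF j k, of b \<sigma>] insert_rank_less_iff[OF k j, of b \<sigma>] by linarith
    qed
  qed auto
  ultimately show "bij_betw (insert_rank n b \<sigma>) {1..Suc n} {1..Suc n}"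
    by (simp add: bij_betw_def endo_inj_surj)
next
  fix x assume "x \<notin> {1..Suc n}"
  then show "insert_rank n b \<sigma> x = x"
    using permutes_not_in[OF \<sigma>, of x] by (auto simp: insert_rank_def)
qed

text \<open>Inversions among the old positions survive; the new ones pair \<open>Suc n\<close> with
  the positions of the \<open>b\<close> largest old ranks.\<close>

lemma inv_count_insert_rank:
  assumes \<sigma>: "\<sigma> permutes {1..n}" and b: "b \<le> n"
  shows "inv_count (Suc n) (insert_rank n b \<sigma>) = inv_count n \<sigma> + b"
proof -
  let ?A = "{(i, j). i \<in> {1..n} \<and> j \<in> {1..n} \<and> i < j \<and> \<sigma> i > \<sigma> j}"
  let ?B = "{i \<in> {1..n}. Suc n - b \<le> \<sigma> i}"
  let ?C = "(\<lambda>i. (i, Suc n)) ` ?B"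
  have eq: "{(i, j). i \<in> {1..Suc n} \<and> j \<in> {1..Suc n} \<and> i < j
      \<and> insert_rank n b \<sigma> i > insert_rank n b \<sigma> j} = ?A \<union> ?C" (is "?L = _")
  proof (rule set_eqI)
    fix p :: "nat \<times> nat"
    obtain i j where p: "p = (i, j)" by (cases p)
    consider "j = Suc n" "i \<in> {1..n}" | "j \<in> {1..n}" "i \<in> {1..n}" | "\<not> (i \<in> {1..n} \<and> j \<in> {1..Suc n})"
      by force
    then show "p \<in> ?L \<longleftrightarrow> p \<in> ?A \<union> ?C"
    proof cases
      case 1
      then show ?thesis by (auto simp: p insert_rank_le)
    next
      case 2
      then show ?thesis using insert_rank_less_iff[of j n i b \<sigma>] by (auto simp: p)
    next
      case 3
      then show ?thesis by (auto simp: p)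
    qed
  qed
  have "finite ?A"
    by (rule finite_subset[of _ "{1..n} \<times> {1..n}"]) auto
  moreover have "card ?C = card ?B"
    by (rule card_image) (auto simp: inj_on_def)
  moreover have "card ?B = card (\<sigma> ` ?B)"
    by (rule card_image[symmetric]) (rule inj_on_subset[OF permutes_inj[OF \<sigma>]], simp)
  moreover have "\<sigma> ` ?B = {Suc n - b..n}"
  proof -
    have "\<sigma> ` {1..n} = {1..n}" by (rule permutes_image[OF \<sigma>])
    moreover have "\<sigma> ` ?B = \<sigma> ` {1..n} \<inter> {Suc n - b..}" by auto
    ultimately show ?thesis using b by auto
  qed
  moreover have "?A \<inter> ?C = {}" by auto
  ultimately show ?thesis
    unfolding inv_count_def eq using b by (subst card_Un_disjoint) auto
qed

text \<open>The last value reveals \<open>b\<close>, and undoing the shift recovers \<sigma>.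
  Surjectivity then follows by counting, as \<open>n! * (n + 1) = (n + 1)!\<close>.\<close>

lemma bij_betw_insert_rank:
  "bij_betw (\<lambda>(\<sigma>, b). insert_rank n b \<sigma>) ({\<sigma>. \<sigma> permutes {1..n}} \<times> {..n})
     {\<pi>. \<pi> permutes {1..Suc n}}"
proof -
  let ?f = "\<lambda>(\<sigma>, b). insert_rank n b \<sigma>"
  let ?D = "{\<sigma>. \<sigma> permutes {1..n}} \<times> {..n}"
  have inj: "inj_on ?f ?D"
  proof (rule inj_onI)
    fix p p'
    assume "p \<in> ?D" "p' \<in> ?D" and f: "?f p = ?f p'"
    then obtain \<sigma> b \<sigma>' b' where p: "p = (\<sigma>, b)" "p' = (\<sigma>', b')"
      and \<sigma>: "\<sigma> permutes {1..n}" and \<sigma>': "\<sigma>' permutes {1..n}" and b: "b \<le> n" "b' \<le> n"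
      by auto
    have eq: "insert_rank n b \<sigma> = insert_rank n b' \<sigma>'" using f p by simp
    have "Suc n - b = Suc n - b'"
      using fun_cong[OF eq, of "Suc n"] by simp
    then have bb': "b = b'" using b by auto
    have "\<sigma> j = \<sigma>' j" for j
    proof (cases "j \<in> {1..n}")
      case True
      then show ?thesis
        using fun_cong[OF eq, of j] by (auto simp: insert_rank_le bb' split: if_splits)
    next
      case False
      then show ?thesis using permutes_not_in[OF \<sigma>] permutes_not_in[OF \<sigma>'] by simp
    qed
    then show "p = p'" using bb' p by auto
  qed
  have "?f ` ?D = {\<pi>. \<pi> permutes {1..Suc n}}"
  proof (rule card_subset_eq)
    show "finite {\<pi>. \<pi> permutes {1..Suc n}}" by (simp add: finite_permutations)
    show "?f ` ?D \<subseteq> {\<pi>. \<pi> permutes {1..Suc n}}"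
      using permutes_insert_rank by auto
    have "card (?f ` ?D) = fact n * Suc n"
      using card_image[OF inj] card_permutations[of "{1..n}" n] by (simp add: card_cartesian_product)
    also have "\<dots> = card {\<pi>. \<pi> permutes {1..Suc n}}"
      using card_permutations[of "{1..Suc n}" "Suc n"] by simp
    finally show "card (?f ` ?D) = card {\<pi>. \<pi> permutes {1..Suc n}}" .
  qed
  with inj show ?thesis by (simp add: bij_betw_def)
qed

text \<open>Under the bijection the weight factors, so the relative rank of the newcomer is
  independent of the earlier order. Two applications strip off the last two candidates.\<close>

lemma mallows_sum_Suc:
  fixes \<theta> :: real
  shows "(\<Sum>\<pi> | \<pi> permutes {1..Suc n}. \<theta> ^ inv_count (Suc n) \<pi> * f \<pi>) =
    (\<Sum>\<sigma> | \<sigma> permutes {1..n}. \<theta> ^ inv_count n \<sigma> * (\<Sum>b\<le>n. \<theta> ^ b * f (insert_rank n b \<sigma>)))"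
proof -
  have "(\<Sum>\<pi> | \<pi> permutes {1..Suc n}. \<theta> ^ inv_count (Suc n) \<pi> * f \<pi>) =
    (\<Sum>(\<sigma>, b)\<in>{\<sigma>. \<sigma> permutes {1..n}} \<times> {..n}.
      \<theta> ^ inv_count (Suc n) (insert_rank n b \<sigma>) * f (insert_rank n b \<sigma>))"
    by (subst sum.reindex_bij_betw[OF bij_betw_insert_rank, symmetric]) (simp add: case_prod_unfold)
  also have "\<dots> = (\<Sum>(\<sigma>, b)\<in>{\<sigma>. \<sigma> permutes {1..n}} \<times> {..n}.
      \<theta> ^ inv_count n \<sigma> * (\<theta> ^ b * f (insert_rank n b \<sigma>)))"
    by (rule sum.cong) (auto simp: inv_count_insert_rank power_add mult.assoc)
  finally show ?thesis
    by (simp add: sum.cartesian_product[symmetric] sum_distrib_left)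
qed

section \<open>Conditioning on the first N - 2 candidates\<close>

definition wins :: "nat \<Rightarrow> (nat \<Rightarrow> (nat \<Rightarrow> nat) \<Rightarrow> bool) \<Rightarrow> (nat \<Rightarrow> nat) \<Rightarrow> bool" where
  "wins N d \<pi> \<longleftrightarrow> \<pi> (accepted d \<pi>) = N - 1"

text \<open>By \<open>partition_fun_Suc\<close> this normalising constant is the \<theta>-analogue
  of \<open>N!\<close>.\<close>

definition partition_fun :: "nat \<Rightarrow> real \<Rightarrow> real" where
  "partition_fun N \<theta> = (\<Sum>\<rho> | \<rho> permutes {1..N}. \<theta> ^ inv_count N \<rho>)"

definition insert_two :: "nat \<Rightarrow> (nat \<Rightarrow> nat) \<Rightarrow> nat \<Rightarrow> nat \<Rightarrow> nat \<Rightarrow> nat" where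
  "insert_two n \<tau> a b = insert_rank (Suc n) b (insert_rank n a \<tau>)"

text \<open>Left unnormalised: the probability of winning given the relative order \<tau> of the
  first \<open>n\<close> candidates, times the sums of all \<open>\<theta> ^ a\<close> and of all
  \<open>\<theta> ^ b\<close>.\<close>

definition cond_win :: "nat \<Rightarrow> real \<Rightarrow> (nat \<Rightarrow> (nat \<Rightarrow> nat) \<Rightarrow> bool) \<Rightarrow> (nat \<Rightarrow> nat) \<Rightarrow> real" where
  "cond_win n \<theta> d \<tau> = (\<Sum>a\<le>n. \<theta> ^ a *
     (\<Sum>b\<le>Suc n. \<theta> ^ b * of_bool (wins (Suc (Suc n)) d (insert_two n \<tau> a b))))"

lemma win_prob_eq_sum:
  assumes "0 < \<theta>"
  shows "win_prob N \<theta> d =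
    (\<Sum>\<pi> | \<pi> permutes {1..N}. \<theta> ^ inv_count N \<pi> * of_bool (wins N d \<pi>)) / partition_fun N \<theta>"
proof -
  let ?M = "mallows_pmf N \<theta>" and ?P = "{\<pi>. \<pi> permutes {1..N}}" and ?W = "{\<pi>. wins N d \<pi>}"
  have fin: "finite ?P" by (simp add: finite_permutations)
  have "set_pmf ?M \<subseteq> ?P"
    by (auto simp: set_pmf_eq pmf_mallows_pmf[OF assms])
  \<comment> \<open>The event may contain functions that are not permutations; it is cut down to the
    finite set \<open>?P\<close>, which carries all the mass.\<close>
  then have "?W \<inter> set_pmf ?M = (?P \<inter> ?W) \<inter> set_pmf ?M" by auto
  then have "measure_pmf.prob ?M ?W = measure_pmf.prob ?M (?P \<inter> ?W)"
    by (metis measure_Int_set_pmf)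
  also have "\<dots> = (\<Sum>\<pi>\<in>?P \<inter> ?W. pmf ?M \<pi>)"
    using fin by (intro measure_measure_pmf_finite) simp
  also have "\<dots> = (\<Sum>\<pi>\<in>?P. pmf ?M \<pi> * of_bool (wins N d \<pi>))"
    using fin by (auto simp: sum.inter_restrict of_bool_def if_distrib intro!: sum.cong)
  also have "\<dots> = (\<Sum>\<pi>\<in>?P. \<theta> ^ inv_count N \<pi> * of_bool (wins N d \<pi>) / partition_fun N \<theta>)"
    by (rule sum.cong) (auto simp: pmf_mallows_pmf[OF assms] partition_fun_def)
  finally show ?thesis
    by (simp add: win_prob_def wins_def sum_divide_distrib)
qed

lemma partition_fun_pos:
  assumes "0 < \<theta>"
  shows "0 < partition_fun N \<theta>"
  unfolding partition_fun_def
  by (rule sum_pos) (use assms permutes_id[of "{1..N}"] in \<open>auto simp: finite_permutations intro: exI[of _ id]\<close>)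

lemma partition_fun_Suc: "partition_fun (Suc n) \<theta> = partition_fun n \<theta> * (\<Sum>b\<le>n. \<theta> ^ b)"
  using mallows_sum_Suc[where f = "\<lambda>_. 1" and \<theta> = \<theta> and n = n]
  by (simp add: partition_fun_def sum_distrib_right)

text \<open>Only \<open>cond_win\<close> depends on the strategy here, so strategies can be compared
  for each \<tau> separately.\<close>

lemma win_prob_cond_win:
  assumes "0 < \<theta>"
  shows "win_prob (Suc (Suc n)) \<theta> d =
    (\<Sum>\<tau> | \<tau> permutes {1..n}. \<theta> ^ inv_count n \<tau> * cond_win n \<theta> d \<tau>) / partition_fun (Suc (Suc n)) \<theta>"
  unfolding win_prob_eq_sum[OF assms] mallows_sum_Suc cond_win_def insert_two_def ..

lemma accepted_eqI:
  assumes "1 \<le> i" "d i \<pi>" "\<And>j. 1 \<le> j \<Longrightarrow> j < i \<Longrightarrow> \<not> d j \<pi>"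
  shows "accepted d \<pi> = i"
  unfolding accepted_def by (rule Least_equality) (use assms not_less in blast)+

lemma permutes_insert_two:
  assumes "\<tau> permutes {1..n}" "a \<le> n" "b \<le> Suc n"
  shows "insert_two n \<tau> a b permutes {1..Suc (Suc n)}"
  unfolding insert_two_def using assms by (intro permutes_insert_rank)

lemma insert_two_last [simp]: "insert_two n \<tau> a b (Suc (Suc n)) = Suc (Suc n) - b"
  by (simp add: insert_two_def)

text \<open>Insertions preserve the order of earlier candidates: times up to \<open>n\<close> see
  neither \<open>a\<close> nor \<open>b\<close>, and time \<open>Suc n\<close> sees \<open>a\<close>
  but not \<open>b\<close>.\<close>

lemma strategy_insert_two:
  assumes d: "strategy (Suc (Suc n)) d" and \<tau>: "\<tau> permutes {1..n}"
    and ab: "a \<le> n" "b \<le> Suc n" "a' \<le> n" "b' \<le> Suc n"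
    and i: "i \<in> {1..Suc n}" "i \<le> n \<or> a = a'"
  shows "d i (insert_two n \<tau> a b) \<longleftrightarrow> d i (insert_two n \<tau> a' b')"
proof -
  have "same_relative_order i (insert_two n \<tau> a b) (insert_two n \<tau> a' b')"
    using i by (auto simp: same_relative_order_def insert_two_def insert_rank_less_iff)
  moreover have "i \<in> {1..Suc (Suc n)}" using i by auto
  ultimately show ?thesis
    using d permutes_insert_two[OF \<tau> ab(1,2)] permutes_insert_two[OF \<tau> ab(3,4)]
    unfolding strategy_def by blast
qed

section \<open>Weights contributed by the last two insertions\<close>

lemma sum_atMost_split_0:
  fixes f :: "nat \<Rightarrow> real"
  shows "(\<Sum>a\<le>n. f a) = f 0 + (\<Sum>a=1..n. f a)"
  by (simp add: atMost_atLeast0 sum.atLeast_Suc_atMost)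

lemma sum_power_gt_1: "(\<Sum>b\<in>{1..Suc n}. \<theta> ^ b * of_bool (1 < b)) = \<theta> * (\<Sum>b=1..n. (\<theta>::real) ^ b)"
  by (induction n) (auto simp: algebra_simps)

text \<open>A candidate ends up second best in two ways: it was best and the newcomer beats everyone
  (\<open>b = 0\<close>), or it was second best and the newcomer lands below it
  (\<open>b \<ge> 2\<close>). The latter weights start at \<open>\<theta> ^ 2\<close>, hence the
  extra factor \<theta>.\<close>

lemma sum_insert_rank_eq:
  fixes \<theta> :: real
  assumes i: "i \<in> {1..Suc n}" and \<sigma>: "\<sigma> i \<le> Suc n"
  shows "(\<Sum>b\<le>Suc n. \<theta> ^ b * of_bool (insert_rank (Suc n) b \<sigma> i = Suc n)) =
    of_bool (\<sigma> i = Suc n) + of_bool (\<sigma> i = n) * \<theta> * (\<Sum>b=1..n. \<theta> ^ b)"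
proof -
  have "insert_rank (Suc n) b \<sigma> i = Suc n \<longleftrightarrow> \<sigma> i = Suc n \<and> b = 0 \<or> \<sigma> i = n \<and> 1 < b" for b
    using i \<sigma> by (auto simp: insert_rank_le)
  then have "(\<Sum>b\<le>Suc n. \<theta> ^ b * of_bool (insert_rank (Suc n) b \<sigma> i = Suc n)) =
      (\<Sum>b\<le>Suc n. \<theta> ^ b * of_bool (\<sigma> i = Suc n \<and> b = 0 \<or> \<sigma> i = n \<and> 1 < b))"
    by (simp only:)
  also have "\<dots> = of_bool (\<sigma> i = Suc n)
      + (\<Sum>b\<in>{1..Suc n}. of_bool (\<sigma> i = n) * (\<theta> ^ b * of_bool (1 < b)))"
    unfolding sum_atMost_split_0[of _ "Suc n"]
    by (intro arg_cong2[where f = "(+)"] sum.cong) auto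
  finally show ?thesis
    by (simp only: sum_distrib_left[symmetric] sum_power_gt_1 mult.assoc)
qed

lemma sum_last_second_best:
  fixes \<theta> :: real
  shows "(\<Sum>b\<le>Suc n. \<theta> ^ b * of_bool (Suc (Suc n) - b = Suc n)) = \<theta>"
proof -
  have "(\<Sum>b\<le>Suc n. \<theta> ^ b * of_bool (Suc (Suc n) - b = Suc n)) = (\<Sum>b\<le>Suc n. if b = 1 then \<theta> else 0)"
    by (rule sum.cong) auto
  then show ?thesis by simp
qed

text \<open>The best treatment of the last two candidates: for \<open>a = 0\<close> stop at
  \<open>Suc n\<close> and win with weight 1 (\<open>b = 0\<close>), otherwise take the last one and
  win with weight \<theta> (\<open>b = 1\<close>).\<close>

lemma optimal_value_eq:
  fixes \<theta> :: real
  shows "(\<Sum>a\<le>n. \<theta> ^ a * (if a = 0 then 1 else \<theta>)) = 1 + \<theta> * (\<Sum>b=1..n. \<theta> ^ b)"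
proof -
  have "(\<Sum>a=1..n. \<theta> ^ a * (if a = 0 then 1 else \<theta>)) = (\<Sum>a=1..n. \<theta> * \<theta> ^ a)"
    by (rule sum.cong) auto
  then show ?thesis by (simp add: sum_atMost_split_0 sum_distrib_left)
qed

text \<open>The threshold \<open>1 / 2\<close> enters here: the full series is
  \<open>\<theta> / (1 - \<theta>)\<close>, which equals 1 at
  \<open>\<theta> = 1 / 2\<close>.\<close>

lemma geometric_sum_le_1:
  fixes \<theta> :: real
  assumes "0 < \<theta>" "\<theta> < 1 / 2"
  shows "(\<Sum>b=1..n. \<theta> ^ b) \<le> 1"
proof -
  have "(\<Sum>b=1..n. \<theta> ^ b) \<le> (\<Sum>b=1..n. (1 / 2) ^ b)"
    using assms by (intro sum_mono power_mono) auto
  also have "\<dots> = 1 - (1 / 2) ^ n"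
    by (induction n) auto
  finally show ?thesis by (smt (verit) zero_le_power divide_nonneg_nonneg)
qed

section \<open>Upper bound for an arbitrary strategy\<close>

lemma cond_win_le:
  assumes \<theta>: "0 < \<theta>" "\<theta> < 1 / 2"
    and d: "strategy (Suc (Suc n)) d" and \<tau>: "\<tau> permutes {1..n}"
  shows "cond_win n \<theta> d \<tau> \<le> 1 + \<theta> * (\<Sum>b=1..n. \<theta> ^ b)"
proof -
  let ?p = "insert_two n \<tau>"
  define S where "S = (\<Sum>b=1..n. \<theta> ^ b)"
  have S: "0 \<le> S" "S \<le> 1"
    using \<theta> geometric_sum_le_1[OF \<theta>] by (auto simp: S_def intro!: sum_nonneg)
  have inner: "(\<Sum>b\<le>Suc n. \<theta> ^ b * of_bool (?p a b i = Suc n)) =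
      of_bool (insert_rank n a \<tau> i = Suc n) + of_bool (insert_rank n a \<tau> i = n) * \<theta> * S"
    if "a \<le> n" "i \<in> {1..Suc n}" for a i
  proof -
    have "insert_rank n a \<tau> i \<in> {1..Suc n}"
      using permutes_in_image[OF permutes_insert_rank[OF \<tau> that(1)]] that(2) by blast
    then show ?thesis
      unfolding insert_two_def S_def using that(2) by (intro sum_insert_rank_eq) auto
  qed
  show ?thesis
  \<comment> \<open>Decisions up to time \<open>n\<close> are the same for all \<open>a\<close> and
    \<open>b\<close>, so \<open>?p 0 0\<close> may stand for every extension of \<tau>.\<close>
  proof (cases "\<exists>i\<in>{1..n}. d i (?p 0 0)")
    case True
    define i where "i = (LEAST i. i \<in> {1..n} \<and> d i (?p 0 0))"
    have i: "i \<in> {1..n}" "d i (?p 0 0)"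
      using LeastI_ex[of "\<lambda>i. i \<in> {1..n} \<and> d i (?p 0 0)"] True unfolding i_def by blast+
    have less: "\<not> d j (?p 0 0)" if "1 \<le> j" "j < i" for j
      using not_less_Least[of j "\<lambda>i. i \<in> {1..n} \<and> d i (?p 0 0)"] that i by (auto simp: i_def)
    have acc: "accepted d (?p a b) = i" if "a \<le> n" "b \<le> Suc n" for a b
    proof (rule accepted_eqI)
      show "1 \<le> i" using i by simp
      show "d i (?p a b)"
        using strategy_insert_two[OF d \<tau> that, of 0 0 i] i by auto
      show "\<not> d j (?p a b)" if "1 \<le> j" "j < i" for j
        using strategy_insert_two[OF d \<tau> \<open>a \<le> n\<close> \<open>b \<le> Suc n\<close>, of 0 0 j] i less that by auto
    qed
    have \<tau>i: "\<tau> i \<in> {1..n}" using permutes_in_image[OF \<tau>] i by blast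
    have "cond_win n \<theta> d \<tau> = (\<Sum>a\<le>n. \<theta> ^ a * (\<Sum>b\<le>Suc n. \<theta> ^ b * of_bool (?p a b i = Suc n)))"
      unfolding cond_win_def by (intro sum.cong refl arg_cong2[where f = "(*)"]) (auto simp: wins_def acc)
    also have "\<dots> = (\<Sum>a\<le>n. \<theta> ^ a *
        (of_bool (insert_rank n a \<tau> i = Suc n) + of_bool (insert_rank n a \<tau> i = n) * \<theta> * S))"
      using i by (intro sum.cong refl arg_cong2[where f = "(*)"] inner) auto
    \<comment> \<open>For \<open>a = 0\<close> the candidate \<open>Suc n\<close> goes on top, so
      candidate \<open>i\<close> keeps its rank and is at best second so far.\<close>
    also have "\<dots> = of_bool (\<tau> i = n) * \<theta> * S + (\<Sum>a=1..n. \<theta> ^ a *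
        (of_bool (insert_rank n a \<tau> i = Suc n) + of_bool (insert_rank n a \<tau> i = n) * \<theta> * S))"
      using i \<tau>i by (subst sum_atMost_split_0) (auto simp: insert_rank_le)
    \<comment> \<open>For \<open>a \<ge> 1\<close> a candidate of rank \<open>n\<close> in \<tau>
      moves up to \<open>Suc n\<close>; any other one reaches at most \<open>n\<close>.\<close>
    also have "\<dots> \<le> of_bool (\<tau> i = n) * \<theta> * S +
        (\<Sum>a=1..n. \<theta> ^ a * (if \<tau> i = n then 1 else \<theta> * S))"
      using i \<tau>i \<theta> S
      by (intro add_left_mono sum_mono mult_left_mono) (auto simp: insert_rank_le)
    also have "\<dots> = (if \<tau> i = n then \<theta> * S + S else S * (\<theta> * S))"
      by (simp add: S_def sum_distrib_right)
    also have "\<dots> \<le> 1 + \<theta> * S"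
    proof -
      have "S * (\<theta> * S) \<le> 1 * (\<theta> * S)" using S \<theta> by (intro mult_right_mono) auto
      then show ?thesis using S by auto
    qed
    finally show ?thesis by (simp add: S_def)
  next
    case False
    have nacc: "\<not> d j (?p a b)" if "a \<le> n" "b \<le> Suc n" "1 \<le> j" "j < Suc n" for a b j
      using strategy_insert_two[OF d \<tau> that(1,2), of 0 0 j] False that by auto
    have "(\<Sum>b\<le>Suc n. \<theta> ^ b * of_bool (wins (Suc (Suc n)) d (?p a b))) \<le> (if a = 0 then 1 else \<theta>)"
      if a: "a \<le> n" for a
    \<comment> \<open>The decision at time \<open>Suc n\<close> cannot depend on \<open>b\<close>,
      so testing it at \<open>b = 0\<close> suffices.\<close>
    proof (cases "d (Suc n) (?p a 0)")
      case True
      have "accepted d (?p a b) = Suc n" if "b \<le> Suc n" for b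
        using nacc[OF a that] True strategy_insert_two[OF d \<tau> a that, of a 0 "Suc n"] a
        by (intro accepted_eqI) auto
      then have "(\<Sum>b\<le>Suc n. \<theta> ^ b * of_bool (wins (Suc (Suc n)) d (?p a b))) =
          (\<Sum>b\<le>Suc n. \<theta> ^ b * of_bool (?p a b (Suc n) = Suc n))"
        by (intro sum.cong) (auto simp: wins_def)
      also have "\<dots> = of_bool (Suc n - a = Suc n) + of_bool (Suc n - a = n) * \<theta> * S"
        using inner[OF a, of "Suc n"] by simp
      \<comment> \<open>The value is 1 for \<open>a = 0\<close>, \<open>\<theta> * S\<close> for
        \<open>a = 1\<close>, and 0 for larger \<open>a\<close>, where two earlier candidates are
        already better.\<close>
      also have "\<dots> \<le> (if a = 0 then 1 else \<theta>)"
        using S \<theta> by (auto simp: mult_left_le)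
      finally show ?thesis .
    next
      case False
      have "accepted d (?p a b) = Suc (Suc n)" if b: "b \<le> Suc n" for b
      proof (rule accepted_eqI)
        show rej: "\<not> d j (?p a b)" if "1 \<le> j" "j < Suc (Suc n)" for j
          using nacc[OF a b that(1)] that(2) False strategy_insert_two[OF d \<tau> a b, of a 0 "Suc n"] a
          by (cases "j = Suc n") auto
        \<comment> \<open>A strategy must accept someone, and all earlier times reject.\<close>
        obtain i where "i \<in> {1..Suc (Suc n)}" "d i (?p a b)"
          using d permutes_insert_two[OF \<tau> a b] unfolding strategy_def by blast
        with rej[of i] show "d (Suc (Suc n)) (?p a b)"
          by (cases "i = Suc (Suc n)") auto
      qed auto
      then have "(\<Sum>b\<le>Suc n. \<theta> ^ b * of_bool (wins (Suc (Suc n)) d (?p a b))) =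
          (\<Sum>b\<le>Suc n. \<theta> ^ b * of_bool (Suc (Suc n) - b = Suc n))"
        by (intro sum.cong) (auto simp: wins_def)
      also have "\<dots> = \<theta>" by (rule sum_last_second_best)
      finally show ?thesis using \<theta> by auto
    qed
    then have "cond_win n \<theta> d \<tau> \<le> (\<Sum>a\<le>n. \<theta> ^ a * (if a = 0 then 1 else \<theta>))"
      unfolding cond_win_def using \<theta> by (intro sum_mono mult_left_mono) auto
    then show ?thesis by (simp only: optimal_value_eq)
  qed
qed

section \<open>Value of the proposed strategy\<close>

lemma strategy_reject_then_lr_max:
  assumes "k < N"
  shows "strategy N (reject_then_lr_max N k)"
proof -
  have "lr_max \<pi> i = lr_max \<rho> i" if "same_relative_order i \<pi> \<rho>" "1 \<le> i" for i \<pi> \<rho>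
    using that by (auto simp: lr_max_def same_relative_order_def)
  then show ?thesis
    using assms by (auto simp: strategy_def reject_then_lr_max_def)
qed

lemma lr_max_insert_two:
  assumes \<tau>: "\<tau> permutes {1..n}" and n: "0 < n" and a: "a \<le> n"
  shows "lr_max (insert_two n \<tau> a b) (Suc n) \<longleftrightarrow> a = 0"
proof -
  have \<tau>n: "\<tau> ` {1..n} = {1..n}" by (rule permutes_image[OF \<tau>])
  have "lr_max (insert_two n \<tau> a b) (Suc n) \<longleftrightarrow>
      (\<forall>j\<in>{1..n}. insert_rank n a \<tau> j < insert_rank n a \<tau> (Suc n))"
    by (auto simp: lr_max_def insert_two_def insert_rank_less_iff atLeastLessThanSuc_atLeastAtMost)
  also have "\<dots> \<longleftrightarrow> (\<forall>j\<in>{1..n}. \<tau> j < Suc n - a)"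
    by (auto simp: insert_rank_le)
  also have "\<dots> \<longleftrightarrow> (\<forall>t\<in>\<tau> ` {1..n}. t < Suc n - a)"
    by blast
  also have "\<dots> \<longleftrightarrow> a = 0"
    \<comment> \<open>Testing at the top rank \<open>n\<close> yields \<open>n < Suc n - a\<close>,
      which forces \<open>a = 0\<close>.\<close>
    unfolding \<tau>n using n a by (auto dest: bspec[where x = n])
  finally show ?thesis .
qed

text \<open>The bound of \<open>cond_win_le\<close> is attained for every \<tau>: the left-to-right
  maximum test at time \<open>Suc n\<close> is exactly the test \<open>a = 0\<close>.\<close>

lemma cond_win_reject_then_lr_max:
  assumes \<tau>: "\<tau> permutes {1..n}" and n: "0 < n"
  shows "cond_win n \<theta> (reject_then_lr_max (Suc (Suc n)) n) \<tau> = 1 + \<theta> * (\<Sum>b=1..n. \<theta> ^ b)"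
proof -
  let ?d = "reject_then_lr_max (Suc (Suc n)) n" and ?p = "insert_two n \<tau>"
  have "(\<Sum>b\<le>Suc n. \<theta> ^ b * of_bool (wins (Suc (Suc n)) ?d (?p a b))) = (if a = 0 then 1 else \<theta>)"
    if a: "a \<le> n" for a
  proof (cases "a = 0")
    case True
    have "accepted ?d (?p a b) = Suc n" for b
      using lr_max_insert_two[OF \<tau> n a, of b] True
      by (intro accepted_eqI) (auto simp: reject_then_lr_max_def)
    then have "(\<Sum>b\<le>Suc n. \<theta> ^ b * of_bool (wins (Suc (Suc n)) ?d (?p a b))) =
        (\<Sum>b\<le>Suc n. \<theta> ^ b * of_bool (insert_rank (Suc n) b (insert_rank n a \<tau>) (Suc n) = Suc n))"
      by (simp add: wins_def insert_two_def)
    then show ?thesis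
      using sum_insert_rank_eq[of "Suc n" n "insert_rank n a \<tau>" \<theta>] True by simp
  next
    case False
    have "accepted ?d (?p a b) = Suc (Suc n)" for b
    proof (rule accepted_eqI)
      show "\<not> ?d j (?p a b)" if "1 \<le> j" "j < Suc (Suc n)" for j
        using that lr_max_insert_two[OF \<tau> n a] False
        by (cases "j = Suc n") (auto simp: reject_then_lr_max_def)
    qed (auto simp: reject_then_lr_max_def)
    then have "(\<Sum>b\<le>Suc n. \<theta> ^ b * of_bool (wins (Suc (Suc n)) ?d (?p a b))) =
        (\<Sum>b\<le>Suc n. \<theta> ^ b * of_bool (Suc (Suc n) - b = Suc n))"
      by (simp add: wins_def)
    then show ?thesis using False by (simp only: sum_last_second_best if_False)
  qed
  then have "cond_win n \<theta> ?d \<tau> = (\<Sum>a\<le>n. \<theta> ^ a * (if a = 0 then 1 else \<theta>))"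
    unfolding cond_win_def by (intro sum.cong) auto
  then show ?thesis by (simp only: optimal_value_eq)
qed

section \<open>Optimality and the limiting win probability\<close>

lemma optimal_reject_then_lr_max:
  assumes \<theta>: "0 < \<theta>" "\<theta> < 1 / 2" and n: "0 < n"
  shows "optimal_strategy (Suc (Suc n)) \<theta> (reject_then_lr_max (Suc (Suc n)) n)"
  unfolding optimal_strategy_def
proof (intro conjI allI impI)
  show "strategy (Suc (Suc n)) (reject_then_lr_max (Suc (Suc n)) n)"
    by (rule strategy_reject_then_lr_max) auto
next
  fix d assume d: "strategy (Suc (Suc n)) d"
  show "win_prob (Suc (Suc n)) \<theta> d
      \<le> win_prob (Suc (Suc n)) \<theta> (reject_then_lr_max (Suc (Suc n)) n)"
    unfolding win_prob_cond_win[OF \<theta>(1)]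
  proof (intro divide_right_mono sum_mono mult_left_mono)
    fix \<tau> assume "\<tau> \<in> {\<tau>. \<tau> permutes {1..n}}"
    then have \<tau>: "\<tau> permutes {1..n}" by blast
    show "cond_win n \<theta> d \<tau> \<le> cond_win n \<theta> (reject_then_lr_max (Suc (Suc n)) n) \<tau>"
      unfolding cond_win_reject_then_lr_max[OF \<tau> n] by (rule cond_win_le[OF \<theta> d \<tau>])
  qed (use \<theta> partition_fun_pos[OF \<theta>(1)] in \<open>auto intro: less_imp_le\<close>)
qed

text \<open>As \<open>cond_win\<close> is constant in \<tau>, the factor
  \<open>partition_fun n \<theta>\<close> cancels and only the last two factors of the normalising
  constant remain.\<close>

lemma win_prob_reject_then_lr_max:
  assumes \<theta>: "0 < \<theta>" and n: "0 < n"
  shows "win_prob (Suc (Suc n)) \<theta> (reject_then_lr_max (Suc (Suc n)) n) =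
    (1 + \<theta> * (\<Sum>b=1..n. \<theta> ^ b)) / ((\<Sum>b\<le>n. \<theta> ^ b) * (\<Sum>b\<le>Suc n. \<theta> ^ b))"
proof -
  have "(\<Sum>\<tau> | \<tau> permutes {1..n}. \<theta> ^ inv_count n \<tau> *
      cond_win n \<theta> (reject_then_lr_max (Suc (Suc n)) n) \<tau>) =
      partition_fun n \<theta> * (1 + \<theta> * (\<Sum>b=1..n. \<theta> ^ b))"
    by (simp add: partition_fun_def sum_distrib_right cond_win_reject_then_lr_max n)
  then show ?thesis
    using partition_fun_pos[OF \<theta>, of n]
    by (simp only: win_prob_cond_win[OF \<theta>] partition_fun_Suc mult.assoc) simp
qed

theorem theorem12:
  fixes \<theta> :: real
  assumes "0 < \<theta>" and "\<theta> < 1 / 2"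
  shows "(\<forall>\<^sub>F N in sequentially. optimal_strategy N \<theta> (reject_then_lr_max N (N - 2))) \<and>
    (\<lambda>N. max_win_prob N \<theta>) \<longlonglongrightarrow> (1 - \<theta>) * (1 - \<theta> + \<theta>\<^sup>2)"
proof
  have opt: "optimal_strategy N \<theta> (reject_then_lr_max N (N - 2))" if "3 \<le> N" for N
  proof -
    \<comment> \<open>Splitting both \<open>N\<close> and \<open>N - 1\<close> exposes two
      successors; \<open>3 \<le> N\<close> makes \<open>n\<close> positive.\<close>
    from that obtain n where "N = Suc (Suc n)" "0 < n"
      by (cases N rule: nat.exhaust[case_product nat.exhaust[of "N - 1"]]) auto
    then show ?thesis using optimal_reject_then_lr_max[OF assms] by simp
  qed
  then show "\<forall>\<^sub>F N in sequentially. optimal_strategy N \<theta> (reject_then_lr_max N (N - 2))"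
    using eventually_sequentially by blast
  have sums: "(\<lambda>n. \<Sum>b\<le>n. \<theta> ^ b) \<longlonglongrightarrow> 1 / (1 - \<theta>)"
    using geometric_sums[of \<theta>] assms by (simp add: sums_def_le)
  \<comment> \<open>The sum from 1 is written as the sum from 0 minus 1, so that the single limit
    \<open>sums\<close> serves all three occurrences.\<close>
  have "(\<lambda>n. (1 + \<theta> * ((\<Sum>b\<le>n. \<theta> ^ b) - 1)) / ((\<Sum>b\<le>n. \<theta> ^ b) * (\<Sum>b\<le>Suc n. \<theta> ^ b)))
      \<longlonglongrightarrow> (1 + \<theta> * (1 / (1 - \<theta>) - 1)) / (1 / (1 - \<theta>) * (1 / (1 - \<theta>)))"
    using assms by (intro tendsto_intros sums LIMSEQ_Suc[OF sums]) auto
  moreover have "(1 + \<theta> * (1 / (1 - \<theta>) - 1)) / (1 / (1 - \<theta>) * (1 / (1 - \<theta>))) = (1 - \<theta>) * (1 - \<theta> + \<theta>\<^sup>2)"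
    using assms by (simp add: field_simps power2_eq_square)
  moreover have "\<forall>\<^sub>F n in sequentially.
        (1 + \<theta> * ((\<Sum>b\<le>n. \<theta> ^ b) - 1)) / ((\<Sum>b\<le>n. \<theta> ^ b) * (\<Sum>b\<le>Suc n. \<theta> ^ b)) = max_win_prob (n + 2) \<theta>"
      using eventually_gt_at_top[of 0]
  proof eventually_elim
    case (elim n)
    have "max_win_prob (n + 2) \<theta> = win_prob (Suc (Suc n)) \<theta> (reject_then_lr_max (Suc (Suc n)) n)"
      using max_win_prob_optimal[OF optimal_reject_then_lr_max[OF assms elim]] by simp
    also have "\<dots> = (1 + \<theta> * ((\<Sum>b\<le>n. \<theta> ^ b) - 1)) / ((\<Sum>b\<le>n. \<theta> ^ b) * (\<Sum>b\<le>Suc n. \<theta> ^ b))"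
      using win_prob_reject_then_lr_max[OF assms(1) elim] by (simp only: sum_atMost_split_0[of _ n]) simp
    finally show ?case by simp
  qed
  ultimately have "(\<lambda>n. max_win_prob (n + 2) \<theta>) \<longlonglongrightarrow> (1 - \<theta>) * (1 - \<theta> + \<theta>\<^sup>2)"
    by (simp only: tendsto_cong)
  then show "(\<lambda>N. max_win_prob N \<theta>) \<longlonglongrightarrow> (1 - \<theta>) * (1 - \<theta> + \<theta>\<^sup>2)"
    by (rule LIMSEQ_offset)
qed

end
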